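(* Let $X$ and $Y$ be two Banach spaces with the WODP. Then the projective tensor product $X\widehat{\otimes}_\pi Y$ has the WODP.
   Context: Banach spaces are over $\mathbb{K}\in\{\mathbb{R},\mathbb{C}\}$; $B_X$, $S_X$ are the closed unit ball and unit sphere. A slice of $B_X$ is a set $\{x\in B_X\colon\mathrm{Re}\,x^*(x)>\sup\mathrm{Re}\,x^*(B_X)-\alpha\}$ with $x^*\in X^*$, $\alpha>0$. $X$ has the weak operator Daugavet property (WODP) if, given $x_1,\ldots,x_n\in S_X$, $\varepsilon>0$, a slice $S$ of $B_X$ and $x'\in B_X$, there exist $x\in S$ and a bounded linear operator $T\colon X\to X$ with $\|T\|\leq 1+\varepsilon$, $\|T(x_i)-x_i\|<\varepsilon$ for every $i\in\{1,\ldots,n\}$ and $\|T(x)-x'\|<\varepsilon$. $X\widehat{\otimes}_\pi Y$ is the completion of $X\otimes Y$ under the norm $\|u\|=\inf\{\sum_{i=1}^n\|x_i\|\|y_i\|\colon u=\sum_{i=1}^nx_i\otimes y_i\}$. *)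

theory Defs
  imports "HOL-Analysis.Analysis"
begin

section \<open>The scalar field\<close>

text \<open>
  The scalars are either \<open>\<real>\<close> or \<open>\<complex>\<close>: a field in this class is identified, by a norm preserving
  embedding of real algebras, with the subfield \<open>\<real>\<close> of \<open>\<complex>\<close> or with the whole of \<open>\<complex>\<close>.
\<close>

class real_or_complex = real_normed_field +
  fixes to_complex :: "'a \<Rightarrow> complex"
  assumes to_complex_add: "to_complex (x + y) = to_complex x + to_complex y"
    and to_complex_mult: "to_complex (x * y) = to_complex x * to_complex y"
    and to_complex_scaleR: "to_complex (scaleR r x) = scaleR r (to_complex x)"
    and norm_to_complex: "norm (to_complex x) = norm x"
    and range_to_complex: "range to_complex = \<real> \<or> range to_complex = UNIV"

instantiation real :: real_or_complex
begin
definition to_complex_real :: "real \<Rightarrow> complex" where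
  "to_complex_real = complex_of_real"
instance
  by standard (auto simp: to_complex_real_def Reals_def scaleR_conv_of_real)
end

instantiation complex :: real_or_complex
begin
definition to_complex_complex :: "complex \<Rightarrow> complex" where
  "to_complex_complex z = z"
instance
  by standard (auto simp: to_complex_complex_def)
end

definition re_part :: "'k::real_or_complex \<Rightarrow> real" where
  "re_part c = Re (to_complex c)"


section \<open>Banach spaces over the scalar field\<close>

text \<open>
  The type class supplies the additive group, the complete norm and the real scalar multiplication;
  the locale adds the multiplication by scalars of \<open>'k\<close>, which has to extend the real one.
\<close>

locale banach_space = vector_space scale
  for scale :: "'k::real_or_complex \<Rightarrow> 'x::banach \<Rightarrow> 'x" +
  assumes scale_of_real: "scale (of_real r) x = r *\<^sub>R x"
    and norm_scale: "norm (scale c x) = norm c * norm x"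

definition bounded_operator ::
    "('k::real_or_complex \<Rightarrow> 'x::banach \<Rightarrow> 'x) \<Rightarrow> ('k \<Rightarrow> 'y::real_normed_vector \<Rightarrow> 'y) \<Rightarrow> ('x \<Rightarrow> 'y) \<Rightarrow> bool"
  where "bounded_operator sX sY T \<longleftrightarrow> Vector_Spaces.linear sX sY T \<and> bounded_linear T"

abbreviation bounded_functional ::
    "('k::real_or_complex \<Rightarrow> 'x::banach \<Rightarrow> 'x) \<Rightarrow> ('x \<Rightarrow> 'k) \<Rightarrow> bool"
  where "bounded_functional sX \<equiv> bounded_operator sX (*)"

definition slice :: "('x::banach \<Rightarrow> 'k::real_or_complex) \<Rightarrow> real \<Rightarrow> 'x set" where
  "slice f \<alpha> = {x \<in> cball 0 1. re_part (f x) > (SUP z\<in>cball 0 1. re_part (f z)) - \<alpha>}"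

definition WODP :: "('k::real_or_complex \<Rightarrow> 'x::banach \<Rightarrow> 'x) \<Rightarrow> bool" where
  "WODP sX \<longleftrightarrow>
    (\<forall>(n::nat) (xs :: nat \<Rightarrow> 'x) (\<epsilon>::real) (f :: 'x \<Rightarrow> 'k) (\<alpha>::real) (x' :: 'x).
      (\<forall>i\<in>{1..n}. xs i \<in> sphere 0 1) \<longrightarrow> \<epsilon> > 0 \<longrightarrow>
      bounded_functional sX f \<longrightarrow> \<alpha> > 0 \<longrightarrow> x' \<in> cball 0 1 \<longrightarrow>
      (\<exists>x\<in>slice f \<alpha>. \<exists>T. bounded_operator sX sX T \<and> onorm T \<le> 1 + \<epsilon> \<and>
        (\<forall>i\<in>{1..n}. norm (T (xs i) - xs i) < \<epsilon>) \<and> norm (T x - x') < \<epsilon>))"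


section \<open>The algebraic tensor product\<close>

definition bilinear_map ::
    "('k::field \<Rightarrow> 'x::ab_group_add \<Rightarrow> 'x) \<Rightarrow> ('k \<Rightarrow> 'y::ab_group_add \<Rightarrow> 'y) \<Rightarrow>
     ('k \<Rightarrow> 'w::ab_group_add \<Rightarrow> 'w) \<Rightarrow> ('x \<Rightarrow> 'y \<Rightarrow> 'w) \<Rightarrow> bool"
  where "bilinear_map sX sY sW B \<longleftrightarrow>
    (\<forall>y. Vector_Spaces.linear sX sW (\<lambda>x. B x y)) \<and> (\<forall>x. Vector_Spaces.linear sY sW (B x))"

text \<open>
  \<open>X \<otimes> Y\<close> is realised inside the algebraic dual of the space of all (not necessarily continuous)
  bilinear forms on \<open>X \<times> Y\<close>, an elementary tensor \<open>x \<otimes> y\<close> being evaluation at \<open>(x, y)\<close>. The value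
  0 off the bilinear forms is a dummy. As a scalar can be moved into the first factor, finite
  sums of elementary tensors exhaust the linear span. The vector space operations are the pointwise
  ones. Lemma \<open>tensor_sum_lift\<close> below is the universal property.
\<close>

definition tensor ::
    "('k::field \<Rightarrow> 'x::ab_group_add \<Rightarrow> 'x) \<Rightarrow> ('k \<Rightarrow> 'y::ab_group_add \<Rightarrow> 'y) \<Rightarrow>
     'x \<Rightarrow> 'y \<Rightarrow> ('x \<Rightarrow> 'y \<Rightarrow> 'k) \<Rightarrow> 'k"
  where "tensor sX sY x y = (\<lambda>B. if bilinear_map sX sY (*) B then B x y else 0)"

definition algebraic_tensor_product ::
    "('k::field \<Rightarrow> 'x::ab_group_add \<Rightarrow> 'x) \<Rightarrow> ('k \<Rightarrow> 'y::ab_group_add \<Rightarrow> 'y) \<Rightarrow>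
     (('x \<Rightarrow> 'y \<Rightarrow> 'k) \<Rightarrow> 'k) set"
  where "algebraic_tensor_product sX sY =
    {u. \<exists>(n::nat) x y. u = (\<lambda>B. \<Sum>i<n. tensor sX sY (x i) (y i) B)}"

definition projective_norm ::
    "('k::real_normed_field \<Rightarrow> 'x::real_normed_vector \<Rightarrow> 'x) \<Rightarrow>
     ('k \<Rightarrow> 'y::real_normed_vector \<Rightarrow> 'y) \<Rightarrow> (('x \<Rightarrow> 'y \<Rightarrow> 'k) \<Rightarrow> 'k) \<Rightarrow> real"
  where "projective_norm sX sY u =
    Inf {\<Sum>i<n. norm (x i) * norm (y i) | (n::nat) x y.
           u = (\<lambda>B. \<Sum>i<n. tensor sX sY (x i) (y i) B)}"


section \<open>The projective tensor product\<close>

text \<open>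
  The Banach space with scalar multiplication \<open>sZ\<close> is a completion of \<open>X \<otimes> Y\<close> under the projective
  norm: \<open>J\<close> is an isometric linear embedding of \<open>X \<otimes> Y\<close> with dense range. A completion is
  determined only up to an isometric isomorphism, hence a predicate.
\<close>

definition is_projective_tensor_product ::
    "('k::real_or_complex \<Rightarrow> 'x::banach \<Rightarrow> 'x) \<Rightarrow> ('k \<Rightarrow> 'y::banach \<Rightarrow> 'y) \<Rightarrow>
     ('k \<Rightarrow> 'z::banach \<Rightarrow> 'z) \<Rightarrow> ((('x \<Rightarrow> 'y \<Rightarrow> 'k) \<Rightarrow> 'k) \<Rightarrow> 'z) \<Rightarrow> bool"
  where "is_projective_tensor_product sX sY sZ J \<longleftrightarrow>
    banach_space sZ \<and>
    (\<forall>u\<in>algebraic_tensor_product sX sY. \<forall>v\<in>algebraic_tensor_product sX sY.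
       J (\<lambda>B. u B + v B) = J u + J v) \<and>
    (\<forall>c. \<forall>u\<in>algebraic_tensor_product sX sY. J (\<lambda>B. c * u B) = sZ c (J u)) \<and>
    (\<forall>u\<in>algebraic_tensor_product sX sY. norm (J u) = projective_norm sX sY u) \<and>
    closure (J ` algebraic_tensor_product sX sY) = UNIV"


section \<open>Adequacy of the encoding\<close>

lemma vector_space_mult: "vector_space ((*) :: 'k::field \<Rightarrow> 'k \<Rightarrow> 'k)"
  by unfold_locales (auto simp: algebra_simps)

lemma separating_functional:
  fixes s :: "'k::field \<Rightarrow> 'w::ab_group_add \<Rightarrow> 'w"
  assumes "vector_space s" and "w \<noteq> 0"
  shows "\<exists>f. Vector_Spaces.linear s (*) f \<and> f w = 1"
proof -
  interpret vector_space_pair s "(*) :: 'k \<Rightarrow> 'k \<Rightarrow> 'k"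
    using assms(1) vector_space_mult by (rule vector_space_pair.intro)
  have "vs1.independent {w}"
    using assms(2) by simp
  from linear_independent_extend[OF this, of "\<lambda>_. 1"] show ?thesis
    by auto
qed

lemma tensor_sum_lift:
  fixes sX :: "'k::field \<Rightarrow> 'x::ab_group_add \<Rightarrow> 'x"
    and sY :: "'k \<Rightarrow> 'y::ab_group_add \<Rightarrow> 'y"
    and sW :: "'k \<Rightarrow> 'w::ab_group_add \<Rightarrow> 'w"
  assumes W: "vector_space sW" and A: "bilinear_map sX sY sW A"
    and eq: "(\<lambda>B. \<Sum>i<m. tensor sX sY (x i) (y i) B) = (\<lambda>B. \<Sum>i<n. tensor sX sY (x' i) (y' i) B)"
  shows "(\<Sum>i<m. A (x i) (y i)) = (\<Sum>i<n. A (x' i) (y' i))"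
proof (rule ccontr)
  let ?w = "(\<Sum>i<m. A (x i) (y i)) - (\<Sum>i<n. A (x' i) (y' i))"
  assume "(\<Sum>i<m. A (x i) (y i)) \<noteq> (\<Sum>i<n. A (x' i) (y' i))"
  then obtain f where f: "Vector_Spaces.linear sW (*) f" "f ?w = 1"
    using separating_functional[OF W, of ?w] by auto
  interpret f: Vector_Spaces.linear sW "(*)" f by (rule f(1))
  have "bilinear_map sX sY (*) (\<lambda>a b. f (A a b))"
    using A f(1) by (auto simp: bilinear_map_def Vector_Spaces.linear_iff)
  then have "(\<Sum>i<m. f (A (x i) (y i))) = (\<Sum>i<n. f (A (x' i) (y' i)))"
    using fun_cong[OF eq, of "\<lambda>a b. f (A a b)"] by (simp add: tensor_def)
  then have "f ?w = 0"
    by (simp add: f.diff f.sum)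
  with f(2) show False by simp
qed

lemma banach_space_mult_real: "banach_space ((*) :: real \<Rightarrow> real \<Rightarrow> real)"
  and banach_space_mult_complex: "banach_space ((*) :: complex \<Rightarrow> complex \<Rightarrow> complex)"
  using vector_space_mult
  by (auto intro!: banach_space.intro banach_space_axioms.intro
      simp: norm_mult scaleR_conv_of_real abs_mult)

text \<open>The identification of the projective tensor product of \<open>K\<close> and \<open>Y\<close> with \<open>Y\<close>:\<close>

lemma is_projective_tensor_product_scalars:
  fixes sY :: "'k::{real_or_complex,banach} \<Rightarrow> 'y::banach \<Rightarrow> 'y"
  assumes "banach_space sY"
  shows "\<exists>J. is_projective_tensor_product (*) sY sY J"
proof -
  interpret Y: banach_space sY by (rule assms)
  have vY: "vector_space sY" by unfold_locales
  have bil: "bilinear_map (*) sY sY sY"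
    unfolding bilinear_map_def
    by (auto simp: Vector_Spaces.linear_iff vY vector_space_mult Y.scale_left_distrib Y.scale_right_distrib
        ac_simps)
  let ?S = "\<lambda>(n::nat) x y. (\<lambda>B. \<Sum>i<n. tensor (*) sY (x i) (y i) B)"
  define R where "R u w \<longleftrightarrow> (\<exists>n x y. u = ?S n x y \<and> w = (\<Sum>i<n. sY (x i) (y i)))" for u w
  define J where "J u = (THE w. R u w)" for u
  have J: "J (?S n x y) = (\<Sum>i<n. sY (x i) (y i))" for n x y
    unfolding J_def
  proof (rule the_equality)
    show "R (?S n x y) (\<Sum>i<n. sY (x i) (y i))" unfolding R_def by blast
    fix w assume "R (?S n x y) w"
    then obtain m x' y' where eq: "?S n x y = ?S m x' y'" and w: "w = (\<Sum>i<m. sY (x' i) (y' i))"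
      unfolding R_def by blast
    show "w = (\<Sum>i<n. sY (x i) (y i))"
      unfolding w by (rule tensor_sum_lift[OF vY bil eq, symmetric])
  qed
  have single: "?S n x y = ?S 1 (\<lambda>_. 1) (\<lambda>_. \<Sum>i<n. sY (x i) (y i))" for n x y
  proof
    fix B
    show "?S n x y B = ?S 1 (\<lambda>_. 1) (\<lambda>_. \<Sum>i<n. sY (x i) (y i)) B"
    proof (cases "bilinear_map (*) sY (*) B")
      case True
      then have l: "Vector_Spaces.linear (*) (*) (\<lambda>x. B x b)" "Vector_Spaces.linear sY (*) (B a)"
        for a b by (auto simp: bilinear_map_def)
      have "B c b = c * B 1 b" for c b
        using module_hom.scale[OF Vector_Spaces.linear.axioms(3)[OF l(1)], of c 1 b] by simp
      then have "(\<Sum>i<n. B (x i) (y i)) = (\<Sum>i<n. x i * B 1 (y i))"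
        by (intro sum.cong refl)
      also have "\<dots> = B 1 (\<Sum>i<n. sY (x i) (y i))"
        by (simp add: module_hom.sum[OF Vector_Spaces.linear.axioms(3)[OF l(2)]]
            module_hom.scale[OF Vector_Spaces.linear.axioms(3)[OF l(2)]])
      finally show ?thesis
        using True by (simp add: tensor_def)
    qed (simp add: tensor_def)
  qed
  define t where "t w = ?S 1 (\<lambda>_. 1) (\<lambda>_. w)" for w
  have Jt: "J (t w) = w" for w unfolding t_def J by simp
  have alg: "algebraic_tensor_product (*) sY = range t"
  proof (intro equalityI subsetI)
    fix u assume "u \<in> algebraic_tensor_product (*) sY"
    then obtain n x y where "u = ?S n x y" unfolding algebraic_tensor_product_def by blast
    then have "u = t (\<Sum>i<n. sY (x i) (y i))" unfolding t_def by (rule trans[OF _ single])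
    then show "u \<in> range t" by blast
  next
    fix u assume "u \<in> range t"
    then obtain w where u: "u = t w" by blast
    show "u \<in> algebraic_tensor_product (*) sY"
      unfolding algebraic_tensor_product_def mem_Collect_eq u t_def by (intro exI) (rule refl)
  qed
  have tB: "t w B = (if bilinear_map (*) sY (*) B then B 1 w else 0)" for w B
    by (simp add: t_def tensor_def)
  have lin: "Vector_Spaces.linear sY (*) (B 1)" if "bilinear_map (*) sY (*) B" for B
    using that by (simp add: bilinear_map_def)
  have add: "(\<lambda>B. t v B + t w B) = t (v + w)" for v w
    by (rule ext) (simp add: tB module_hom.add[OF Vector_Spaces.linear.axioms(3)[OF lin]])
  have scl: "(\<lambda>B. c * t w B) = t (sY c w)" for c w
    by (rule ext) (simp add: tB module_hom.scale[OF Vector_Spaces.linear.axioms(3)[OF lin]])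
  have nrm: "projective_norm (*) sY (t w) = norm w" for w
    unfolding projective_norm_def
  proof (rule cInf_eq_minimum)
    show "norm w \<in> {\<Sum>i<n. norm (x i) * norm (y i) | n x y. t w = ?S n x y}"
      unfolding mem_Collect_eq
      by (rule exI[of _ 1], rule exI[of _ "\<lambda>_. 1"], rule exI[of _ "\<lambda>_. w"]) (simp add: t_def)
  next
    fix r assume "r \<in> {\<Sum>i<n. norm (x i) * norm (y i) | n x y. t w = ?S n x y}"
    then obtain n x y where r: "r = (\<Sum>i<n. norm (x i) * norm (y i))" "t w = ?S n x y"
      unfolding mem_Collect_eq by (elim exE conjE)
    have "w = (\<Sum>i<n. sY (x i) (y i))" using Jt[of w] unfolding r(2) J by (rule sym)
    then show "norm w \<le> r"
      unfolding r(1) by (simp add: sum_norm_le Y.norm_scale)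
  qed
  have "J ` range t = UNIV" by (simp add: image_image Jt)
  then have "is_projective_tensor_product (*) sY sY J"
    unfolding is_projective_tensor_product_def alg using assms
    by (auto simp: add scl nrm Jt)
  then show ?thesis by blast
qed

end

theory Submission
  imports Defs
begin

text \<open>
  The proof tensors operators of \<open>X\<close> with operators of \<open>Y\<close>. Fix finitely many vectors of \<open>Z\<close>, a slice
  given by \<open>g\<close>, and a target \<open>z'\<close> in the ball of \<open>Z\<close>. Since the unit ball of \<open>Z\<close> is the closed convex
  hull of the elementary tensors of unit ball vectors (\<open>cball_subset_closure_unit_tensors\<close>), the
  target is nearly a convex combination \<open>\<Sum>\<^sub>j l\<^sub>j a\<^sub>j \<otimes> b\<^sub>j\<close> and the slice contains one elementary tensor
  \<open>x\<^sub>0 \<otimes> y\<^sub>0\<close>. If \<open>P\<close> and \<open>Q\<close> almost fix the factors occurring in good approximations of the given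
  vectors, then \<open>P \<otimes> Q\<close> almost fixes these vectors. It remains to find \<open>x\<^sub>j, y\<^sub>j\<close> in the unit balls
  with \<open>P x\<^sub>j\<close> near \<open>a\<^sub>j\<close>, \<open>Q y\<^sub>j\<close> near \<open>b\<^sub>j\<close>, and every \<open>x\<^sub>j \<otimes> y\<^sub>j\<close> in the slice: by convexity
  \<open>\<Sum>\<^sub>j l\<^sub>j x\<^sub>j \<otimes> y\<^sub>j\<close> then lies in the slice, and \<open>P \<otimes> Q\<close> sends it close to \<open>z'\<close>.

  This needs one operator that serves several slices and several targets simultaneously, while the
  WODP offers a single slice and a single target. The passage is \<open>WODP_several_slices\<close>: operators
  for one slice at a time are composed, each almost fixing the vectors that matter for the others.
  It is applied first in \<open>X\<close>, with all slices equal to \<open>{x. Re g(x \<otimes> y\<^sub>0) > c}\<close>, which contains \<open>x\<^sub>0\<close>,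
  and then in \<open>Y\<close> with the slices \<open>{y. Re g(x\<^sub>j \<otimes> y) > c}\<close>, which all contain \<open>y\<^sub>0\<close> by the choice of
  the \<open>x\<^sub>j\<close>.

  The operator \<open>P \<otimes> Q\<close> comes from the universal property of the projective tensor product for
  bounded bilinear maps (\<open>bounded_bilinear_lift\<close>).
\<close>


section \<open>Real parts and slices\<close>

lemma bounded_linear_re_part: "bounded_linear (re_part :: 'k::real_or_complex \<Rightarrow> real)"
proof (rule bounded_linear_intro[where K = 1])
  show "norm (re_part x) \<le> norm x * 1" for x :: 'k
    using abs_Re_le_cmod[of "to_complex x"] by (simp add: re_part_def norm_to_complex)
qed (simp_all add: re_part_def to_complex_add to_complex_scaleR)

lemma bounded_operatorD:
  fixes sX :: "'k::real_or_complex \<Rightarrow> 'x::banach \<Rightarrow> 'x"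
    and sY :: "'k \<Rightarrow> 'y::real_normed_vector \<Rightarrow> 'y"
  assumes "bounded_operator sX sY T"
  shows "bounded_linear T" "T (x + y) = T x + T y" "T (sX c x) = sY c (T x)"
  using assms by (auto simp: bounded_operator_def Vector_Spaces.linear_iff)

lemma bounded_linear_re_functional:
  assumes "bounded_functional sX f"
  shows "bounded_linear (\<lambda>x. re_part (f x))"
  using bounded_linear_compose[OF bounded_linear_re_part bounded_operatorD(1)[OF assms]] .

lemma bdd_above_re_functional:
  fixes sX :: "'k::real_or_complex \<Rightarrow> 'x::banach \<Rightarrow> 'x"
  assumes "bounded_functional sX f"
  shows "bdd_above ((\<lambda>z. re_part (f z)) ` cball 0 1)"
proof -
  interpret bounded_linear "\<lambda>x. re_part (f x)"
    by (rule bounded_linear_re_functional[OF assms])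
  obtain K where K: "K > 0" "\<And>x. norm (re_part (f x)) \<le> norm x * K"
    using pos_bounded by blast
  show ?thesis
  proof (rule bdd_aboveI2)
    fix x :: 'x assume "x \<in> cball 0 1"
    then have "norm x * K \<le> 1 * K" using K(1) by (intro mult_right_mono) auto
    then show "re_part (f x) \<le> K" using K(2)[of x] by simp
  qed
qed

lemma convex_re_halfspaces:
  assumes "bounded_functional sX f"
  shows "convex {x. re_part (f x) > c}" "convex {x. re_part (f x) \<le> c}"
    "closed {x. re_part (f x) \<le> c}"
proof -
  interpret bounded_linear "\<lambda>x. re_part (f x)"
    by (rule bounded_linear_re_functional[OF assms])
  have "convex ((\<lambda>x. re_part (f x)) -` {c<..})" "convex ((\<lambda>x. re_part (f x)) -` {..c})"
    by (auto intro!: convex_linear_vimage linear)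
  then show "convex {x. re_part (f x) > c}" "convex {x. re_part (f x) \<le> c}"
    by (auto simp: vimage_def)
  show "closed {x. re_part (f x) \<le> c}"
    by (intro closed_Collect_le continuous_intros continuous_on linear_continuous_on[OF bounded_linear_axioms])
qed

lemma convex_slice:
  assumes "bounded_functional sX f"
  shows "convex (slice f \<alpha>)"
proof -
  have "slice f \<alpha> = cball 0 1 \<inter> {x. re_part (f x) > (SUP z\<in>cball 0 1. re_part (f z)) - \<alpha>}"
    by (auto simp: slice_def)
  then show ?thesis
    using convex_re_halfspaces(1)[OF assms] by (simp add: convex_Int)
qed


section \<open>Several slices at once\<close>

text \<open>
  One tolerance bounds both the excess of the norm over 1 and the displacement of the points of
  \<open>F\<close>, so that the property passes to a larger tolerance as a whole.
\<close>

definition almost_fixing ::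
    "('k::real_or_complex \<Rightarrow> 'x::banach \<Rightarrow> 'x) \<Rightarrow> 'x set \<Rightarrow> real \<Rightarrow> ('x \<Rightarrow> 'x) \<Rightarrow> bool"
  where "almost_fixing sX F \<epsilon> T \<longleftrightarrow>
    bounded_operator sX sX T \<and> onorm T \<le> 1 + \<epsilon> \<and> (\<forall>v\<in>F. norm (T v - v) < \<epsilon>)"

lemma almost_fixingD:
  assumes "almost_fixing sX F \<epsilon> T"
  shows "bounded_operator sX sX T" "bounded_linear T" "onorm T \<le> 1 + \<epsilon>"
    "v \<in> F \<Longrightarrow> norm (T v - v) < \<epsilon>"
    "norm (T x) \<le> (1 + \<epsilon>) * norm x"
proof -
  show *: "bounded_operator sX sX T" "onorm T \<le> 1 + \<epsilon>" "v \<in> F \<Longrightarrow> norm (T v - v) < \<epsilon>"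
    using assms by (auto simp: almost_fixing_def)
  show bl: "bounded_linear T" by (rule bounded_operatorD(1)[OF *(1)])
  have "norm (T x) \<le> onorm T * norm x" by (rule onorm[OF bl])
  also have "\<dots> \<le> (1 + \<epsilon>) * norm x" using *(2) by (intro mult_right_mono) auto
  finally show "norm (T x) \<le> (1 + \<epsilon>) * norm x" .
qed

lemma almost_fixing_mono:
  assumes "almost_fixing sX F \<delta> T" "E \<subseteq> F" "\<delta> \<le> \<epsilon>"
  shows "almost_fixing sX E \<epsilon> T"
  using assms unfolding almost_fixing_def by (meson add_left_mono order_trans order_less_le_trans subsetD)

text \<open>
  A half space that meets the ball in \<open>x0\<close> cuts out a slice, of depth \<open>s - c\<close> for \<open>s\<close> the supremum
  of the functional. Vectors of arbitrary norm can be almost fixed, because fixing their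
  normalisations up to \<open>\<epsilon> / M\<close> is enough when \<open>M\<close> exceeds all norms.
\<close>

lemma WODP_single_slice:
  fixes sX :: "'k::real_or_complex \<Rightarrow> 'x::banach \<Rightarrow> 'x"
  assumes W: "WODP sX" and F: "finite F" and "\<epsilon> > 0"
    and f: "bounded_functional sX f" and x0: "x0 \<in> cball 0 1" "re_part (f x0) > c"
    and a: "a \<in> cball 0 1"
  shows "\<exists>x T. almost_fixing sX F \<epsilon> T \<and> x \<in> cball 0 1 \<and> re_part (f x) > c \<and> norm (T x - a) < \<epsilon>"
proof -
  define s where "s = (SUP z\<in>cball 0 1. re_part (f z))"
  have "re_part (f x0) \<le> s"
    unfolding s_def by (rule cSUP_upper[OF x0(1) bdd_above_re_functional[OF f]])
  then have "s - c > 0" using x0(2) by simp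
  define M where "M = 1 + (\<Sum>v\<in>F. norm v)"
  have M: "M \<ge> 1" "v \<in> F \<Longrightarrow> norm v < M" for v
    using F member_le_sum[of v F norm] by (auto simp: M_def sum_nonneg)
  define \<delta> where "\<delta> = \<epsilon> / M"
  have \<delta>: "\<delta> > 0" "\<delta> \<le> \<epsilon>" "\<delta> * M = \<epsilon>"
    using \<open>\<epsilon> > 0\<close> M(1) by (auto simp: \<delta>_def field_simps)
  define N where "N = (\<lambda>v. v /\<^sub>R norm v) ` (F - {0})"
  have "finite N" using F by (simp add: N_def)
  then obtain h where h: "bij_betw h {1..card N} N"
    using ex_bij_betw_nat_finite_1 by blast
  have "\<forall>i\<in>{1..card N}. h i \<in> sphere 0 1"
  proof
    fix i assume "i \<in> {1..card N}"
    then have "h i \<in> N" using bij_betwE[OF h] by blast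
    then obtain v where "h i = v /\<^sub>R norm v" "v \<noteq> 0" by (auto simp: N_def)
    then show "h i \<in> sphere 0 1" by simp
  qed
  from W[unfolded WODP_def, THEN spec, THEN spec, THEN spec, THEN spec, THEN spec, THEN spec,
      THEN mp, OF this, THEN mp, OF \<delta>(1), THEN mp, OF f, THEN mp, OF \<open>s - c > 0\<close>, THEN mp, OF a]
  obtain x T where x: "x \<in> slice f (s - c)" and T: "bounded_operator sX sX T" "onorm T \<le> 1 + \<delta>"
    "\<forall>i\<in>{1..card N}. norm (T (h i) - h i) < \<delta>" "norm (T x - a) < \<delta>" by blast
  interpret T: bounded_linear T by (rule bounded_operatorD(1)[OF T(1)])
  have N: "norm (T u - u) < \<delta>" if "u \<in> N" for u
    using T(3) that h by (metis bij_betw_imp_surj_on imageE)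
  have "norm (T v - v) < \<epsilon>" if v: "v \<in> F" for v
  proof (cases "v = 0")
    case True
    then show ?thesis using \<open>\<epsilon> > 0\<close> by (simp add: T.zero)
  next
    case False
    let ?u = "v /\<^sub>R norm v"
    have "T v - v = norm v *\<^sub>R (T ?u - ?u)"
      using False by (simp add: T.scaleR scaleR_diff_right)
    then have "norm (T v - v) = norm v * norm (T ?u - ?u)" by simp
    also have "\<dots> \<le> norm v * \<delta>"
      using N[of ?u] v False by (intro mult_left_mono less_imp_le) (auto simp: N_def)
    also have "\<dots> < M * \<delta>" using M(2)[OF v] \<delta>(1) by simp
    finally show ?thesis using \<delta>(3) by (simp add: mult.commute)
  qed
  then have "almost_fixing sX F \<epsilon> T"
    using T(1,2) \<delta>(2) by (auto simp: almost_fixing_def)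
  moreover have "x \<in> cball 0 1" "re_part (f x) > c"
    using x by (auto simp: slice_def s_def)
  moreover have "norm (T x - a) < \<epsilon>" using T(4) \<delta>(2) by simp
  ultimately show ?thesis by blast
qed

lemma almost_fixing_compose_estimate:
  assumes "bounded_linear T" "onorm T \<le> 1 + \<delta>" "0 < \<delta>" "\<delta> \<le> 1" "3 * \<delta> \<le> \<epsilon>"
    and "norm (u - v) < \<delta>" "norm (T v - w) < \<delta>"
  shows "norm (T u - w) < \<epsilon>"
proof -
  interpret bounded_linear T by fact
  have "norm (T (u - v)) \<le> onorm T * norm (u - v)" by (rule onorm[OF assms(1)])
  also have "\<dots> \<le> 2 * \<delta>"
    using assms by (intro mult_mono) auto
  finally have "norm (T u - T v) \<le> 2 * \<delta>" by (simp add: diff)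
  moreover have "norm (T u - w) \<le> norm (T u - T v) + norm (T v - w)"
    using norm_triangle_ineq[of "T u - T v" "T v - w"] by simp
  ultimately show ?thesis using assms by linarith
qed

text \<open>
  Suppose that \<open>T\<close> serves the slices in \<open>I\<close>, with vectors \<open>x j\<close>, and that \<open>m\<close> is a new index. If
  \<open>T\<close> also almost fixes the new target \<open>a m\<close>, and \<open>S\<close> serves the slice of \<open>m\<close> with a vector \<open>y\<close> while
  almost fixing all \<open>x j\<close>, then \<open>T \<circ> S\<close> serves all slices: it moves \<open>x j\<close> via (nearly) \<open>x j\<close> to
  \<open>a j\<close>, and \<open>y\<close> via (nearly) \<open>a m\<close> to \<open>a m\<close>.
\<close>

lemma WODP_several_slices:
  fixes sX :: "'k::real_or_complex \<Rightarrow> 'x::banach \<Rightarrow> 'x"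
  assumes X: "banach_space sX" and W: "WODP sX" and I: "finite I" and "finite F" and "\<epsilon> > 0"
    and "\<And>j. j \<in> I \<Longrightarrow> bounded_functional sX (f j)"
    and "\<And>j. j \<in> I \<Longrightarrow> \<exists>x\<in>cball 0 1. re_part (f j x) > c j"
    and "\<And>j. j \<in> I \<Longrightarrow> a j \<in> cball 0 1"
  shows "\<exists>x T. almost_fixing sX F \<epsilon> T \<and>
    (\<forall>j\<in>I. x j \<in> cball 0 1 \<and> re_part (f j (x j)) > c j \<and> norm (T (x j) - a j) < \<epsilon>)"
  using I assms(4-8)
proof (induction I arbitrary: F \<epsilon> rule: finite_induct)
  case empty
  interpret banach_space sX by (rule X)
  have "almost_fixing sX F \<epsilon> (\<lambda>v. v)"
    using empty.prems(2) onorm_id_le[where 'a = 'x]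
    by (simp add: almost_fixing_def bounded_operator_def Vector_Spaces.linear_iff
        vector_space_axioms)
  then show ?case by auto
next
  case (insert m I)
  define \<delta> where "\<delta> = min 1 (\<epsilon> / 3)"
  have \<delta>: "0 < \<delta>" "\<delta> \<le> 1" "3 * \<delta> \<le> \<epsilon>" using insert.prems(2) by (auto simp: \<delta>_def)
  obtain x T where T: "almost_fixing sX (insert (a m) F) \<delta> T" and
    x: "\<And>j. j \<in> I \<Longrightarrow> x j \<in> cball 0 1 \<and> re_part (f j (x j)) > c j \<and> norm (T (x j) - a j) < \<delta>"
    using insert.IH[of "insert (a m) F" \<delta>] insert.prems \<delta>(1)
    by (metis finite.insertI insertI2)
  obtain x0 where x0: "x0 \<in> cball 0 1" "re_part (f m x0) > c m"
    using insert.prems(4) by blast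
  obtain y S where S: "almost_fixing sX (F \<union> x ` I) \<delta> S"
    and y: "y \<in> cball 0 1" "re_part (f m y) > c m" "norm (S y - a m) < \<delta>"
    using WODP_single_slice[OF W _ \<delta>(1) insert.prems(3)[OF insertI1] x0 insert.prems(5)[OF insertI1],
        of "F \<union> x ` I"] insert.prems(1) insert.hyps(1) by auto
  note est = almost_fixing_compose_estimate[OF almost_fixingD(2,3)[OF T] \<delta>]
  have "almost_fixing sX F \<epsilon> (T \<circ> S)"
    unfolding almost_fixing_def
  proof (intro conjI ballI)
    show "bounded_operator sX sX (T \<circ> S)"
      using almost_fixingD(1)[OF T] almost_fixingD(1)[OF S]
      by (auto simp: bounded_operator_def Vector_Spaces.linear_iff bounded_linear_compose comp_def)
    have "onorm (T \<circ> S) \<le> onorm T * onorm S"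
      by (rule onorm_compose[OF almost_fixingD(2)[OF T] almost_fixingD(2)[OF S]])
    also have "\<dots> \<le> (1 + \<delta>) * (1 + \<delta>)"
      using almost_fixingD(3)[OF T] almost_fixingD(3)[OF S] \<delta>(1)
        onorm_pos_le[OF almost_fixingD(2)[OF S]] by (intro mult_mono) auto
    also have "\<dots> \<le> 1 + \<epsilon>"
      using \<delta> mult_right_mono[OF \<delta>(2), of \<delta>]
      by (simp only: distrib_right distrib_left mult_1_left mult_1_right) linarith
    finally show "onorm (T \<circ> S) \<le> 1 + \<epsilon>" .
  next
    fix v assume v: "v \<in> F"
    show "norm ((T \<circ> S) v - v) < \<epsilon>"
      using est[OF almost_fixingD(4)[OF S] almost_fixingD(4)[OF T]] v by simp
  qed
  moreover have "norm ((T \<circ> S) (x j) - a j) < \<epsilon>" if "j \<in> I" for j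
    using est[OF almost_fixingD(4)[OF S], of "x j" "a j"] x[OF that] that by simp
  moreover have "norm ((T \<circ> S) y - a m) < \<epsilon>"
    using est[OF y(3) almost_fixingD(4)[OF T]] by simp
  ultimately show ?case
    using x y insert.hyps(2)
    by (intro exI[of _ "x(m := y)"] exI[of _ "T \<circ> S"]) (auto simp del: o_apply)
qed


section \<open>Extension of densely defined operators\<close>

lemma sum_append:
  fixes f g :: "nat \<Rightarrow> 'a::comm_monoid_add"
  shows "(\<Sum>i<m + n. if i < m then f i else g (i - m)) = (\<Sum>i<m. f i) + (\<Sum>i<n. g i)"
  by (induction n) (auto simp: ac_simps)

lemma banach_space_tendsto_scale:
  assumes "banach_space s" "u \<longlonglongrightarrow> v"
  shows "(\<lambda>n. s c (u n)) \<longlonglongrightarrow> s c v"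
proof -
  interpret banach_space s by fact
  have "bounded_linear (s c)"
  proof (rule bounded_linear_intro[where K = "norm c"])
    show "s c (r *\<^sub>R x) = r *\<^sub>R s c x" for r x
      unfolding scale_of_real[symmetric] by (simp add: mult.commute)
  qed (simp_all add: scale_right_distrib norm_scale mult.commute)
  then show ?thesis using assms(2) by (rule bounded_linear.tendsto)
qed

text \<open>
  The operator is given by its graph \<open>R\<close>. The extension has as graph the closure \<open>G\<close> of \<open>R\<close>: linearity
  and the bound pass to limits, the bound makes \<open>G\<close> single-valued, and completeness together with
  density makes it total. A relation is convenient because an element of the tensor product has many
  representations, and the bound alone settles well-definedness.
\<close>

lemma densely_defined_operator_extends:
  fixes sZ :: "'k::real_or_complex \<Rightarrow> 'z::banach \<Rightarrow> 'z" and sW :: "'k \<Rightarrow> 'w::banach \<Rightarrow> 'w"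
  assumes Z: "banach_space sZ" and W: "banach_space sW"
    and add: "\<And>z w z' w'. R z w \<Longrightarrow> R z' w' \<Longrightarrow> R (z + z') (w + w')"
    and scl: "\<And>c z w. R z w \<Longrightarrow> R (sZ c z) (sW c w)"
    and bnd: "\<And>z w. R z w \<Longrightarrow> norm w \<le> K * norm z"
    and dense: "closure {z. \<exists>w. R z w} = UNIV"
  shows "\<exists>T. bounded_operator sZ sW T \<and> (\<forall>z w. R z w \<longrightarrow> T z = w) \<and> (\<forall>z. norm (T z) \<le> K * norm z)"
proof -
  interpret Z: banach_space sZ by (rule Z)
  interpret W: banach_space sW by (rule W)
  have diff: "R (z - z') (w - w')" if "R z w" "R z' w'" for z w z' w'
    using add[OF that(1) scl[OF that(2), of "- 1"]] by simp
  define G where "G z w \<longleftrightarrow> (\<exists>u v. (\<forall>n. R (u n) (v n)) \<and> u \<longlonglongrightarrow> z \<and> v \<longlonglongrightarrow> w)" for z w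
  have GI: "G z w" if "\<And>n. R (u n) (v n)" "u \<longlonglongrightarrow> z" "v \<longlonglongrightarrow> w" for u v z w
    using that unfolding G_def by blast
  have GE: "\<exists>u v. (\<forall>n. R (u n) (v n)) \<and> u \<longlonglongrightarrow> z \<and> v \<longlonglongrightarrow> w" if "G z w" for z w
    using that unfolding G_def .
  have Gadd: "G (z + z') (w + w')" if zw: "G z w" "G z' w'" for z w z' w'
  proof -
    obtain u v where 1: "\<And>n. R (u n) (v n)" "u \<longlonglongrightarrow> z" "v \<longlonglongrightarrow> w" using GE[OF zw(1)] by blast
    obtain u' v' where 2: "\<And>n. R (u' n) (v' n)" "u' \<longlonglongrightarrow> z'" "v' \<longlonglongrightarrow> w'" using GE[OF zw(2)] by blast
    show ?thesis
      by (rule GI[OF add[OF 1(1) 2(1)] tendsto_add[OF 1(2) 2(2)] tendsto_add[OF 1(3) 2(3)]])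
  qed
  have Gscl: "G (sZ c z) (sW c w)" if zw: "G z w" for c z w
  proof -
    obtain u v where 1: "\<And>n. R (u n) (v n)" "u \<longlonglongrightarrow> z" "v \<longlonglongrightarrow> w" using GE[OF zw(1)] by blast
    show ?thesis
      by (rule GI[OF scl[OF 1(1)] banach_space_tendsto_scale[OF Z 1(2)]
            banach_space_tendsto_scale[OF W 1(3)]])
  qed
  have Gbnd: "norm w \<le> K * norm z" if zw: "G z w" for z w
  proof -
    obtain u v where 1: "\<And>n. R (u n) (v n)" "u \<longlonglongrightarrow> z" "v \<longlonglongrightarrow> w" using GE[OF zw(1)] by blast
    show ?thesis
      by (rule LIMSEQ_le[OF tendsto_norm[OF 1(3)] tendsto_mult_left[OF tendsto_norm[OF 1(2)]]])
        (use bnd[OF 1(1)] in blast)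
  qed
  have Gex: "\<exists>w. G z w" for z
  proof -
    have "z \<in> closure {z. \<exists>w. R z w}" using dense by simp
    then obtain u where u: "\<And>n. \<exists>w. R (u n) w" "u \<longlonglongrightarrow> z"
      unfolding closure_sequential by blast
    obtain v where v: "\<And>n. R (u n) (v n)" using u(1) by metis
    have "Cauchy v"
    proof (rule metric_CauchyI)
      fix e :: real assume "e > 0"
      then have "e / (\<bar>K\<bar> + 1) > 0" by simp
      then obtain M where M: "\<And>m n. m \<ge> M \<Longrightarrow> n \<ge> M \<Longrightarrow> dist (u m) (u n) < e / (\<bar>K\<bar> + 1)"
        using metric_CauchyD[OF LIMSEQ_imp_Cauchy[OF u(2)]] by blast
      have "dist (v m) (v n) < e" if mn: "m \<ge> M" "n \<ge> M" for m n
      proof -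
        have "dist (v m) (v n) \<le> K * dist (u m) (u n)"
          using bnd[OF diff[OF v v]] by (simp add: dist_norm)
        also have "\<dots> \<le> (\<bar>K\<bar> + 1) * dist (u m) (u n)" by (intro mult_right_mono) auto
        also have "\<dots> < e" using M[OF mn] by (simp add: field_simps)
        finally show ?thesis .
      qed
      then show "\<exists>M. \<forall>m\<ge>M. \<forall>n\<ge>M. dist (v m) (v n) < e" by blast
    qed
    then obtain w where "v \<longlonglongrightarrow> w" using Cauchy_convergent convergent_def by blast
    then show ?thesis using GI[OF v u(2)] by blast
  qed
  have Guniq: "w = w'" if "G z w" "G z w'" for z w w'
    using Gbnd[OF Gadd[OF that(1) Gscl[OF that(2), of "- 1"]]] by simp
  obtain T where T: "\<And>z. G z (T z)" using Gex by metis
  have "T (z + z') = T z + T z'" for z z' by (rule Guniq[OF T Gadd[OF T T]])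
  moreover have scale: "T (sZ c z) = sW c (T z)" for c z by (rule Guniq[OF T Gscl[OF T]])
  moreover have "T (r *\<^sub>R z) = r *\<^sub>R T z" for r z
    using scale[of "of_real r" z] by (simp add: Z.scale_of_real W.scale_of_real)
  ultimately have "bounded_operator sZ sW T"
    unfolding bounded_operator_def Vector_Spaces.linear_iff
    using Gbnd[OF T] Z.vector_space_axioms W.vector_space_axioms
    by (auto intro!: bounded_linear_intro[where K = K] simp: mult.commute)
  moreover have "T z = w" if "R z w" for z w
    by (rule Guniq[OF T GI[of "\<lambda>_. z" "\<lambda>_. w"]]) (use that in auto)
  ultimately show ?thesis using Gbnd[OF T] by blast
qed


section \<open>Elementary tensors\<close>

lemma norm_normalized_le_1: "norm (u /\<^sub>R norm u) \<le> 1" for u :: "'a::real_normed_vector"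
  by (cases "u = 0") auto

locale projective_tensor_product = X: banach_space sX + Y: banach_space sY
  for sX :: "'k::real_or_complex \<Rightarrow> 'x::banach \<Rightarrow> 'x" and sY :: "'k \<Rightarrow> 'y::banach \<Rightarrow> 'y" +
  fixes sZ :: "'k \<Rightarrow> 'z::banach \<Rightarrow> 'z" and J :: "(('x \<Rightarrow> 'y \<Rightarrow> 'k) \<Rightarrow> 'k) \<Rightarrow> 'z"
  assumes ptp: "is_projective_tensor_product sX sY sZ J"
begin

abbreviation tensor_sum :: "nat \<Rightarrow> (nat \<Rightarrow> 'x) \<Rightarrow> (nat \<Rightarrow> 'y) \<Rightarrow> ('x \<Rightarrow> 'y \<Rightarrow> 'k) \<Rightarrow> 'k" where
  "tensor_sum n x y \<equiv> (\<lambda>B. \<Sum>i<n. tensor sX sY (x i) (y i) B)"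

definition elementary :: "'x \<Rightarrow> 'y \<Rightarrow> 'z" where
  "elementary x y = J (tensor sX sY x y)"

lemma banach_space_Z: "banach_space sZ"
  using ptp by (simp add: is_projective_tensor_product_def)

sublocale Z: banach_space sZ
  by (rule banach_space_Z)

lemma tensor_sum_mem: "tensor_sum n x y \<in> algebraic_tensor_product sX sY"
  unfolding algebraic_tensor_product_def mem_Collect_eq by (intro exI) (rule refl)

lemma tensor_mem: "tensor sX sY x y \<in> algebraic_tensor_product sX sY"
  using tensor_sum_mem[of "\<lambda>_. x" "\<lambda>_. y" 1] by simp

lemma J_add:
  "u \<in> algebraic_tensor_product sX sY \<Longrightarrow> v \<in> algebraic_tensor_product sX sY \<Longrightarrow>
    J (\<lambda>B. u B + v B) = J u + J v"
  using ptp by (simp add: is_projective_tensor_product_def)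

lemma J_scale:
  "u \<in> algebraic_tensor_product sX sY \<Longrightarrow> J (\<lambda>B. c * u B) = sZ c (J u)"
  using ptp by (simp add: is_projective_tensor_product_def)

lemma J_tensor_sum: "J (tensor_sum n x y) = (\<Sum>i<n. elementary (x i) (y i))"
proof (induction n)
  case 0
  have "J (\<lambda>B. 0) = J (\<lambda>B. 0) + J (\<lambda>B. 0)"
    using J_add[OF tensor_sum_mem[of _ _ 0] tensor_sum_mem[of _ _ 0]] by simp
  then show ?case by simp
next
  case (Suc n)
  then show ?case
    using J_add[OF tensor_sum_mem[of x y n] tensor_mem[of "x n" "y n"]]
    by (simp add: elementary_def)
qed

lemma bilinear_elementary: "bilinear_map sX sY sZ elementary"
proof -
  have lin: "B (x + x') y = B x y + B x' y" "B (sX c x) y = c * B x y"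
    "B x (y + y') = B x y + B x y'" "B x (sY c y) = c * B x y"
    if "bilinear_map sX sY (*) B" for B c x x' y y'
    using that by (auto simp: bilinear_map_def Vector_Spaces.linear_iff)
  have "tensor sX sY (x + x') y = (\<lambda>B. tensor sX sY x y B + tensor sX sY x' y B)"
    "tensor sX sY x (y + y') = (\<lambda>B. tensor sX sY x y B + tensor sX sY x y' B)"
    "tensor sX sY (sX c x) y = (\<lambda>B. c * tensor sX sY x y B)"
    "tensor sX sY x (sY c y) = (\<lambda>B. c * tensor sX sY x y B)" for x x' y y' c
    by (auto simp: tensor_def lin fun_eq_iff)
  then show ?thesis
    unfolding bilinear_map_def Vector_Spaces.linear_iff elementary_def
    by (simp add: J_add J_scale tensor_mem X.vector_space_axioms Y.vector_space_axioms
        Z.vector_space_axioms)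
qed

text \<open>
  The norm of a sum of elementary tensors is an infimum over its representations. The next two
  lemmas are the two halves of this fact: the first bounds the norm from below, the second produces
  an almost optimal representation.
\<close>

lemma norm_J_tensor_sum_greatest:
  assumes "\<And>m x' y'. tensor_sum n x y = tensor_sum m x' y' \<Longrightarrow>
    r \<le> (\<Sum>i<m. norm (x' i) * norm (y' i))"
  shows "r \<le> norm (\<Sum>i<n. elementary (x i) (y i))"
proof -
  have "r \<le> projective_norm sX sY (tensor_sum n x y)"
    unfolding projective_norm_def
  proof (rule cInf_greatest)
    have "(\<Sum>i<n. norm (x i) * norm (y i)) \<in>
        {\<Sum>i<m. norm (x' i) * norm (y' i) |m x' y'. tensor_sum n x y = tensor_sum m x' y'}"
      unfolding mem_Collect_eq by (intro exI conjI) (rule refl)+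
    then show "{\<Sum>i<m. norm (x' i) * norm (y' i) |m x' y'. tensor_sum n x y = tensor_sum m x' y'} \<noteq> {}"
      by (rule ex_in_conv[THEN iffD1, OF exI])
  next
    fix q assume "q \<in> {\<Sum>i<m. norm (x' i) * norm (y' i) |m x' y'. tensor_sum n x y = tensor_sum m x' y'}"
    then obtain m x' y' where "q = (\<Sum>i<m. norm (x' i) * norm (y' i))"
      "tensor_sum n x y = tensor_sum m x' y'"
      unfolding mem_Collect_eq by (elim exE conjE)
    then show "r \<le> q" using assms by simp
  qed
  also have "\<dots> = norm (J (tensor_sum n x y))"
    using ptp tensor_sum_mem by (simp add: is_projective_tensor_product_def)
  finally show ?thesis by (simp add: J_tensor_sum)
qed

lemma norm_less_tensor_sumE:
  assumes "norm (\<Sum>i<n. elementary (x i) (y i)) < r"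
  obtains m x' y' where "tensor_sum n x y = tensor_sum m x' y'"
    "(\<Sum>i<m. norm (x' i) * norm (y' i)) < r"
proof (rule ccontr)
  note * = that
  assume no: "\<not> thesis"
  have "r \<le> (\<Sum>i<m. norm (x' i) * norm (y' i))"
    if eq: "tensor_sum n x y = tensor_sum m x' y'" for m x' y'
  proof (rule ccontr)
    assume "\<not> ?thesis"
    then have "(\<Sum>i<m. norm (x' i) * norm (y' i)) < r" by simp
    from *[OF eq this] no show False by (rule notE[rotated])
  qed
  then have "r \<le> norm (\<Sum>i<n. elementary (x i) (y i))" by (rule norm_J_tensor_sum_greatest)
  with assms show False by simp
qed

lemma norm_elementary_le: "norm (elementary x y) \<le> norm x * norm y"
proof -
  have "projective_norm sX sY (tensor sX sY x y) \<le> norm x * norm y"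
    unfolding projective_norm_def
  proof (rule cInf_lower)
    show "bdd_below {\<Sum>i<n. norm (x' i) * norm (y' i) |n x' y'. tensor sX sY x y = tensor_sum n x' y'}"
      by (rule bdd_belowI[of _ 0]) (auto intro!: sum_nonneg)
    show "norm x * norm y \<in>
        {\<Sum>i<n. norm (x' i) * norm (y' i) |n x' y'. tensor sX sY x y = tensor_sum n x' y'}"
      unfolding mem_Collect_eq
      by (rule exI[of _ 1], rule exI[of _ "\<lambda>_. x"], rule exI[of _ "\<lambda>_. y"]) simp
  qed
  then show ?thesis
    using ptp tensor_mem by (simp add: is_projective_tensor_product_def elementary_def)
qed

lemma elementary_linear:
  "elementary (x + x') y = elementary x y + elementary x' y"
  "elementary x (y + y') = elementary x y + elementary x y'"
  "elementary (sX c x) y = sZ c (elementary x y)"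
  "elementary x (sY c y) = sZ c (elementary x y)"
  using bilinear_elementary by (auto simp: bilinear_map_def Vector_Spaces.linear_iff)

lemma bounded_bilinear_elementary: "bounded_bilinear elementary"
proof
  show "elementary (r *\<^sub>R x) y = r *\<^sub>R elementary x y"
    "elementary x (r *\<^sub>R y) = r *\<^sub>R elementary x y" for r x y
    using elementary_linear(3)[of "of_real r"] elementary_linear(4)[of _ "of_real r"]
    by (simp_all add: X.scale_of_real Y.scale_of_real Z.scale_of_real)
  show "\<exists>K. \<forall>x y. norm (elementary x y) \<le> norm x * norm y * K"
    by (rule exI[of _ 1]) (simp add: norm_elementary_le)
qed (rule elementary_linear)+

sublocale elementary: bounded_bilinear elementary
  by (rule bounded_bilinear_elementary)

lemma bounded_functional_elementary:
  assumes "bounded_functional sZ g"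
  shows "bounded_functional sX (\<lambda>x. g (elementary x y))" "bounded_functional sY (\<lambda>y. g (elementary x y))"
  using bounded_operatorD[OF assms] vector_space_mult
  by (auto simp: bounded_operator_def Vector_Spaces.linear_iff X.vector_space_axioms
      Y.vector_space_axioms elementary_linear
      intro: bounded_linear_compose[of g] elementary.bounded_linear_left elementary.bounded_linear_right)

lemma approximation_by_elementary_sums:
  assumes "r > norm z" "e > 0"
  shows "\<exists>(n::nat) x y. norm (z - (\<Sum>i<n. elementary (x i) (y i))) < e \<and>
    (\<Sum>i<n. norm (x i) * norm (y i)) < r"
proof -
  define d where "d = min e (r - norm z)"
  have "d > 0" using assms by (simp add: d_def)
  have "z \<in> closure (J ` algebraic_tensor_product sX sY)"
    using ptp by (simp add: is_projective_tensor_product_def)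
  then obtain u where u: "u \<in> algebraic_tensor_product sX sY" "dist (J u) z < d"
    unfolding closure_approachable using \<open>d > 0\<close> by blast
  then obtain n x y where xy: "u = tensor_sum n x y"
    unfolding algebraic_tensor_product_def mem_Collect_eq by (elim exE)
  let ?w = "\<Sum>i<n. elementary (x i) (y i)"
  have d: "norm (?w - z) < d"
    using u(2) by (simp add: xy J_tensor_sum dist_norm)
  have "norm ?w < r"
    using d norm_triangle_ineq2[of ?w z] by (simp add: d_def)
  then obtain m x' y' where eq: "tensor_sum n x y = tensor_sum m x' y'"
    and lt: "(\<Sum>i<m. norm (x' i) * norm (y' i)) < r"
    by (rule norm_less_tensor_sumE)
  have "?w = (\<Sum>i<m. elementary (x' i) (y' i))"
    using arg_cong[OF eq, of J] by (simp only: J_tensor_sum)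
  with d have "norm (z - (\<Sum>i<m. elementary (x' i) (y' i))) < d"
    by (simp add: norm_minus_commute)
  with lt show ?thesis
    by (intro exI[of _ m] exI[of _ x'] exI[of _ y']) (simp add: d_def)
qed

text \<open>
  Sending \<open>\<Sum> x\<^sub>i \<otimes> y\<^sub>i\<close> to \<open>\<Sum> A x\<^sub>i y\<^sub>i\<close> gives the same value \<open>w\<close> for all representations of the same
  tensor. Hence \<open>norm w\<close> is at most \<open>K * (\<Sum> norm x\<^sub>i * norm y\<^sub>i)\<close> for each of them, and so at most
  \<open>K\<close> times the projective norm, which is their infimum. The rest is extension by density.
\<close>

lemma bounded_bilinear_lift:
  fixes sW :: "'k \<Rightarrow> 'w::banach \<Rightarrow> 'w"
  assumes W: "banach_space sW" and A: "bilinear_map sX sY sW A"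
    and bnd: "\<And>x y. norm (A x y) \<le> K * (norm x * norm y)" and "K \<ge> 0"
  shows "\<exists>T. bounded_operator sZ sW T \<and> (\<forall>x y. T (elementary x y) = A x y) \<and>
    (\<forall>z. norm (T z) \<le> K * norm z)"
proof -
  interpret W: banach_space sW by (rule W)
  define R where "R z w \<longleftrightarrow> (\<exists>(n::nat) x y. z = (\<Sum>i<n. elementary (x i) (y i)) \<and>
    w = (\<Sum>i<n. A (x i) (y i)))" for z w
  have RI: "R (\<Sum>i<n. elementary (x i) (y i)) (\<Sum>i<n. A (x i) (y i))" for n :: nat and x y
    unfolding R_def by blast
  have "\<exists>T. bounded_operator sZ sW T \<and> (\<forall>z w. R z w \<longrightarrow> T z = w) \<and> (\<forall>z. norm (T z) \<le> K * norm z)"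
  proof (rule densely_defined_operator_extends[OF banach_space_Z W])
    fix z w z' w' assume "R z w" "R z' w'"
    then obtain n n' :: nat and x y x' y' where
      1: "z = (\<Sum>i<n. elementary (x i) (y i))" "w = (\<Sum>i<n. A (x i) (y i))" and
      2: "z' = (\<Sum>i<n'. elementary (x' i) (y' i))" "w' = (\<Sum>i<n'. A (x' i) (y' i))"
      unfolding R_def by (elim exE conjE)
    have append: "(\<Sum>i<n + n'. C (if i < n then x i else x' (i - n)) (if i < n then y i else y' (i - n))) =
      (\<Sum>i<n. C (x i) (y i)) + (\<Sum>i<n'. C (x' i) (y' i))" for C :: "'x \<Rightarrow> 'y \<Rightarrow> 'c::comm_monoid_add"
      unfolding sum_append[symmetric] by (rule sum.cong) auto
    show "R (z + z') (w + w')"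
      using RI[of "\<lambda>i. if i < n then x i else x' (i - n)" "\<lambda>i. if i < n then y i else y' (i - n)" "n + n'"]
      unfolding append 1 2 .
  next
    fix c z w assume "R z w"
    then obtain n :: nat and x y where
      1: "z = (\<Sum>i<n. elementary (x i) (y i))" "w = (\<Sum>i<n. A (x i) (y i))"
      unfolding R_def by (elim exE conjE)
    have "A (sX c x) y = sW c (A x y)" for x y
      using A by (auto simp: bilinear_map_def Vector_Spaces.linear_iff)
    then show "R (sZ c z) (sW c w)"
      using RI[of "\<lambda>i. sX c (x i)" y n]
      by (simp add: 1 elementary_linear Z.scale_sum_right W.scale_sum_right)
  next
    fix z w assume "R z w"
    then obtain n :: nat and x y where
      1: "z = (\<Sum>i<n. elementary (x i) (y i))" "w = (\<Sum>i<n. A (x i) (y i))"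
      unfolding R_def by (elim exE conjE)
    have le: "norm w \<le> K * (\<Sum>i<m. norm (x' i) * norm (y' i))"
      if eq: "tensor_sum n x y = tensor_sum m x' y'" for m x' y'
      unfolding 1 tensor_sum_lift[OF W.vector_space_axioms A eq] sum_distrib_left
      by (rule sum_norm_le) (rule bnd)
    show "norm w \<le> K * norm z"
    proof (cases "K = 0")
      case True
      then show ?thesis using le[OF refl] by simp
    next
      case False
      then have "norm w / K \<le> norm z"
        unfolding 1(1) using \<open>K \<ge> 0\<close> le
        by (intro norm_J_tensor_sum_greatest) (simp add: field_simps)
      then show ?thesis using False \<open>K \<ge> 0\<close> by (simp add: field_simps)
    qed
  next
    have "\<exists>w. R (J u) w" if u: "u \<in> algebraic_tensor_product sX sY" for u
    proof -
      obtain n x y where "u = tensor_sum n x y"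
        using u unfolding algebraic_tensor_product_def mem_Collect_eq by (elim exE)
      then show ?thesis using RI by (auto simp: J_tensor_sum)
    qed
    then have "J ` algebraic_tensor_product sX sY \<subseteq> {z. \<exists>w. R z w}" by blast
    then show "closure {z. \<exists>w. R z w} = UNIV"
      using closure_mono ptp unfolding is_projective_tensor_product_def by blast
  qed
  moreover have "R (elementary x y) (A x y)" for x y
    using RI[of "\<lambda>_. x" "\<lambda>_. y" 1] by simp
  ultimately show ?thesis by blast
qed

lemma tensor_product_operator:
  assumes P: "bounded_operator sX sX P" and Q: "bounded_operator sY sY Q"
  shows "\<exists>T. bounded_operator sZ sZ T \<and> (\<forall>x y. T (elementary x y) = elementary (P x) (Q y)) \<and>
    onorm T \<le> onorm P * onorm Q"
proof -
  note P' = bounded_operatorD[OF P] and Q' = bounded_operatorD[OF Q]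
  have nonneg: "0 \<le> onorm P * onorm Q"
    using onorm_pos_le[OF P'(1)] onorm_pos_le[OF Q'(1)] by simp
  have bil: "bilinear_map sX sY sZ (\<lambda>x y. elementary (P x) (Q y))"
    by (simp add: bilinear_map_def Vector_Spaces.linear_iff P' Q' elementary_linear
        X.vector_space_axioms Y.vector_space_axioms Z.vector_space_axioms)
  have "norm (elementary (P x) (Q y)) \<le> onorm P * onorm Q * (norm x * norm y)" for x y
  proof -
    have "norm (elementary (P x) (Q y)) \<le> norm (P x) * norm (Q y)" by (rule norm_elementary_le)
    also have "\<dots> \<le> (onorm P * norm x) * (onorm Q * norm y)"
      by (intro mult_mono onorm P'(1) Q'(1) mult_nonneg_nonneg onorm_pos_le) auto
    finally show ?thesis by (simp add: ac_simps)
  qed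
  from bounded_bilinear_lift[OF banach_space_Z bil this nonneg] show ?thesis
    using onorm_bound[OF nonneg] by blast
qed


section \<open>The unit ball of the projective tensor product\<close>

definition unit_tensors :: "'z set" where
  "unit_tensors = {elementary x y | x y. x \<in> cball 0 1 \<and> y \<in> cball 0 1}"

lemma unit_tensorsI: "norm x \<le> 1 \<Longrightarrow> norm y \<le> 1 \<Longrightarrow> elementary x y \<in> unit_tensors"
  by (auto simp: unit_tensors_def)

text \<open>
  A vector \<open>z\<close> of the ball is within \<open>e / 2\<close> of a sum \<open>w\<close> of elementary tensors whose norms have
  products adding up to less than \<open>r = 1 + e / 2\<close>. Normalising the factors makes \<open>w / r\<close> a combination
  of unit tensors with weights of sum at most 1.
\<close>

lemma cball_subset_closure_unit_tensors: "cball 0 1 \<subseteq> closure (convex hull unit_tensors)"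
proof
  fix z :: 'z assume "z \<in> cball 0 1"
  then have z: "norm z \<le> 1" by simp
  show "z \<in> closure (convex hull unit_tensors)"
    unfolding closure_approachable
  proof (intro allI impI)
    fix e :: real assume "e > 0"
    define r where "r = 1 + e / 2"
    have r: "r > 1" using \<open>e > 0\<close> by (simp add: r_def)
    obtain n :: nat and x y where near: "norm (z - (\<Sum>i<n. elementary (x i) (y i))) < e / 2"
      and total: "(\<Sum>i<n. norm (x i) * norm (y i)) < r"
      using approximation_by_elementary_sums[of z r "e / 2"] z r \<open>e > 0\<close> by auto
    define w where "w = (\<Sum>i<n. elementary (x i) (y i))"
    let ?C = "convex hull unit_tensors"
    have zero: "0 \<in> ?C"
      by (rule hull_inc) (auto simp: unit_tensors_def elementary.zero_left intro!: exI[of _ 0])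
    define l where "l i = norm (x i) * norm (y i) / r" for i
    define v where "v i = elementary (x i /\<^sub>R norm (x i)) (y i /\<^sub>R norm (y i))" for i
    have v: "v i \<in> ?C" for i
      unfolding v_def by (intro hull_inc unit_tensorsI norm_normalized_le_1)
    have l: "l i *\<^sub>R v i = (1 / r) *\<^sub>R elementary (x i) (y i)" for i
      by (cases "x i = 0 \<or> y i = 0")
        (auto simp: l_def v_def elementary.scaleR_left elementary.scaleR_right
          elementary.zero_left elementary.zero_right field_simps)
    have L: "(\<Sum>i<n. l i) \<le> 1"
      using total r by (simp add: l_def sum_divide_distrib[symmetric])
    \<comment> \<open>the missing weight is put on the zero tensor\<close>
    have "(\<Sum>i<Suc n. (if i < n then l i else 1 - (\<Sum>i<n. l i)) *\<^sub>R (if i < n then v i else 0)) \<in> ?C"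
      by (rule convex_sum) (use L v zero r in \<open>auto simp: l_def convex_convex_hull\<close>)
    then have "(\<Sum>i<n. l i *\<^sub>R v i) \<in> ?C" by simp
    then have mem: "(1 / r) *\<^sub>R w \<in> ?C" by (simp add: l w_def scaleR_sum_right)
    have "norm w \<le> r"
      unfolding w_def using total norm_elementary_le
      by (smt (verit, best) sum_norm_le)
    have "w - (1 / r) *\<^sub>R w = (1 - 1 / r) *\<^sub>R w" by (simp add: scaleR_diff_left)
    then have "norm (w - (1 / r) *\<^sub>R w) = (1 - 1 / r) * norm w" using r by simp
    also have "\<dots> \<le> (1 - 1 / r) * r" using r \<open>norm w \<le> r\<close> by (intro mult_left_mono) auto
    also have "\<dots> = e / 2" using r by (simp add: r_def field_simps)
    finally have "norm (z - (1 / r) *\<^sub>R w) < e"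
      using near norm_triangle_ineq[of "z - w" "w - (1 / r) *\<^sub>R w"] by (simp add: w_def)
    then show "\<exists>c\<in>?C. dist c z < e"
      using mem by (metis dist_commute dist_norm)
  qed
qed

text \<open>
  Otherwise the closed half space complementary to the slice would contain the closed convex hull
  of the unit tensors, which includes the whole ball.
\<close>

lemma slice_contains_unit_tensor:
  assumes g: "bounded_functional sZ g" and "\<alpha> > 0"
  shows "\<exists>x\<in>cball 0 1. \<exists>y\<in>cball 0 1. re_part (g (elementary x y)) > (SUP z\<in>cball 0 1. re_part (g z)) - \<alpha>"
proof (rule ccontr)
  let ?s = "SUP z\<in>cball 0 1. re_part (g z)"
  assume "\<not> ?thesis"
  then have "unit_tensors \<subseteq> {z. re_part (g z) \<le> ?s - \<alpha>}"
    by (force simp: unit_tensors_def not_less)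
  then have "closure (convex hull unit_tensors) \<subseteq> {z. re_part (g z) \<le> ?s - \<alpha>}"
    by (intro closure_minimal hull_minimal convex_re_halfspaces[OF g])
  then have "?s \<le> ?s - \<alpha>"
    using cball_subset_closure_unit_tensors by (intro cSUP_least) auto
  then show False using \<open>\<alpha> > 0\<close> by simp
qed


section \<open>Tensor products of almost fixing operators\<close>

lemma elementary_diff_estimate:
  assumes "norm (x - a) \<le> d" "norm (y - b) \<le> d"
  shows "norm (elementary x y - elementary a b) \<le> d * norm y + norm a * d"
proof -
  have "elementary x y - elementary a b = elementary (x - a) y + elementary a (y - b)"
    by (simp add: elementary.diff_left elementary.diff_right)
  also have "norm \<dots> \<le> norm (x - a) * norm y + norm a * norm (y - b)"
    by (intro norm_triangle_mono norm_elementary_le)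
  also have "\<dots> \<le> d * norm y + norm a * d"
    using assms norm_ge_zero[THEN order_trans, OF assms(1)]
    by (intro add_mono mult_mono) auto
  finally show ?thesis .
qed

text \<open>
  To almost fix \<open>z\<close> it is enough to almost fix a nearby \<open>\<Sum> x\<^sub>i \<otimes> y\<^sub>i\<close>, since \<open>T\<close> has norm at most 4, and
  for this it is enough to almost fix the finitely many factors \<open>x\<^sub>i\<close> and \<open>y\<^sub>i\<close>. The number 4 is
  available because \<open>P\<close> and \<open>Q\<close> can be taken of norm at most 2.
\<close>

lemma tensor_product_almost_fixing:
  assumes "finite V" "\<eta> > 0"
  shows "\<exists>F E \<delta>. finite F \<and> finite E \<and> 0 < \<delta> \<and> (\<forall>P Q T.
    almost_fixing sX F \<delta> P \<longrightarrow> almost_fixing sY E \<delta> Q \<longrightarrow>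
    bounded_linear T \<longrightarrow> onorm T \<le> 4 \<longrightarrow> (\<forall>x y. T (elementary x y) = elementary (P x) (Q y)) \<longrightarrow>
    (\<forall>z\<in>V. norm (T z - z) < \<eta>))"
  using assms(1)
proof (induction V rule: finite_induct)
  case empty
  show ?case by (intro exI[of _ "{}"] exI[of _ 1]) auto
next
  case (insert z V)
  obtain F E \<delta> where IH: "finite F" "finite E" "0 < \<delta>"
    "\<And>P Q T. almost_fixing sX F \<delta> P \<Longrightarrow> almost_fixing sY E \<delta> Q \<Longrightarrow> bounded_linear T \<Longrightarrow>
      onorm T \<le> 4 \<Longrightarrow> (\<forall>x y. T (elementary x y) = elementary (P x) (Q y)) \<Longrightarrow>
      \<forall>z\<in>V. norm (T z - z) < \<eta>"
    using insert.IH by blast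
  obtain n :: nat and x y where "norm (z - (\<Sum>i<n. elementary (x i) (y i))) < \<eta> / 10"
    using approximation_by_elementary_sums[of z "norm z + 1" "\<eta> / 10"] \<open>\<eta> > 0\<close> by auto
  then obtain w where w: "w = (\<Sum>i<n. elementary (x i) (y i))" and wz: "norm (z - w) < \<eta> / 10"
    by blast
  \<comment> \<open>\<open>norm (Q y) \<le> 2 * norm y\<close> gives \<open>norm (T w - w) \<le> d * (M - 1) \<le> \<eta> / 2\<close>; replacing \<open>z\<close> by \<open>w\<close>
    costs less than \<open>4 * \<eta> / 10\<close> in \<open>T z\<close> and \<open>\<eta> / 10\<close> in \<open>z\<close>\<close>
  define M where "M = 1 + (\<Sum>i<n. 2 * norm (y i) + norm (x i))"
  have M: "M \<ge> 1" by (simp add: M_def sum_nonneg)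
  define d where "d = min \<delta> (min 1 (\<eta> / (2 * M)))"
  have "\<eta> / (2 * M) > 0" using \<open>\<eta> > 0\<close> M by simp
  then have d: "0 < d" "d \<le> \<delta>" "d \<le> 1" "d \<le> \<eta> / (2 * M)" using IH(3) by (auto simp: d_def)
  have dM: "d * M \<le> \<eta> / 2" using d(4) M by (simp add: field_simps)
  have "norm (T v - v) < \<eta>"
    if P: "almost_fixing sX (F \<union> x ` {..<n}) d P" and Q: "almost_fixing sY (E \<union> y ` {..<n}) d Q"
      and T: "bounded_linear T" "onorm T \<le> 4" "\<forall>x y. T (elementary x y) = elementary (P x) (Q y)"
      and v: "v \<in> insert z V" for P Q T v
  proof (cases "v \<in> V")
    case True
    have "almost_fixing sX F \<delta> P" "almost_fixing sY E \<delta> Q"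
      using almost_fixing_mono[OF P _ d(2)] almost_fixing_mono[OF Q _ d(2)] by auto
    then show ?thesis using IH(4)[OF _ _ T] True by blast
  next
    case False
    interpret T: bounded_linear T by (rule T(1))
    have "T w - w = (\<Sum>i<n. elementary (P (x i)) (Q (y i)) - elementary (x i) (y i))"
      by (simp add: w T.sum T(3) sum_subtractf)
    also have "norm \<dots> \<le> (\<Sum>i<n. d * (2 * norm (y i) + norm (x i)))"
    proof (rule sum_norm_le)
      fix i assume i: "i \<in> {..<n}"
      have "norm (elementary (P (x i)) (Q (y i)) - elementary (x i) (y i)) \<le>
          d * norm (Q (y i)) + norm (x i) * d"
        using i by (intro elementary_diff_estimate less_imp_le almost_fixingD(4)[OF P]
            almost_fixingD(4)[OF Q]) auto
      also have "norm (Q (y i)) \<le> (1 + d) * norm (y i)" by (rule almost_fixingD(5)[OF Q])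
      also have "\<dots> \<le> 2 * norm (y i)" using d(3) by (intro mult_right_mono) auto
      finally show "norm (elementary (P (x i)) (Q (y i)) - elementary (x i) (y i)) \<le>
          d * (2 * norm (y i) + norm (x i))" using d(1) by (simp add: algebra_simps)
    qed
    also have "\<dots> = d * (M - 1)" by (simp add: M_def sum_distrib_left)
    also have "\<dots> \<le> \<eta> / 2" using dM d(1) by (simp add: algebra_simps)
    finally have 1: "norm (T w - w) \<le> \<eta> / 2" .
    have "norm (T (z - w)) \<le> onorm T * norm (z - w)" by (rule onorm[OF T(1)])
    also have "\<dots> \<le> 4 * norm (z - w)" using T(2) by (intro mult_right_mono) auto
    finally have 2: "norm (T (z - w)) < 4 * (\<eta> / 10)" using wz by linarith
    have "T z - z = T (z - w) + (T w - w) - (z - w)" by (simp add: T.diff)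
    then have "norm (T z - z) \<le> norm (T (z - w)) + norm (T w - w) + norm (z - w)"
      using norm_triangle_ineq4[of "T (z - w) + (T w - w)" "z - w"]
        norm_triangle_ineq[of "T (z - w)" "T w - w"] by simp
    then have "norm (T z - z) < \<eta>" using 1 2 wz by linarith
    then show ?thesis using False v by simp
  qed
  then show ?case
    using IH(1,2) d(1)
    by (intro exI[of _ "F \<union> x ` {..<n}"] exI[of _ "E \<union> y ` {..<n}"] exI[of _ d]) simp
qed


section \<open>The WODP of the projective tensor product\<close>

lemma WODP_projective_tensor_product:
  assumes WX: "WODP sX" and WY: "WODP sY"
  shows "WODP sZ"
  unfolding WODP_def
proof (intro allI impI)
  fix n :: nat and zs :: "nat \<Rightarrow> 'z" and \<epsilon> :: real and g :: "'z \<Rightarrow> 'k" and \<alpha> :: real and z' :: 'z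
  assume "\<epsilon> > 0" and g: "bounded_functional sZ g" and "\<alpha> > 0" and z': "z' \<in> cball 0 1"
  define c where "c = (SUP z\<in>cball 0 1. re_part (g z)) - \<alpha>"
  obtain F E \<delta>0 where FE: "finite F" "finite E" "0 < \<delta>0"
    "\<And>P Q T. almost_fixing sX F \<delta>0 P \<Longrightarrow> almost_fixing sY E \<delta>0 Q \<Longrightarrow> bounded_linear T \<Longrightarrow>
      onorm T \<le> 4 \<Longrightarrow> (\<forall>x y. T (elementary x y) = elementary (P x) (Q y)) \<Longrightarrow>
      \<forall>z\<in>zs ` {1..n}. norm (T z - z) < \<epsilon>"
    using tensor_product_almost_fixing[of "zs ` {1..n}" \<epsilon>] \<open>\<epsilon> > 0\<close> by blast
  define \<delta> where "\<delta> = min \<delta>0 (min 1 (\<epsilon> / 6))"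
  have \<delta>: "0 < \<delta>" "\<delta> \<le> \<delta>0" "\<delta> \<le> 1" "6 * \<delta> \<le> \<epsilon>" using FE(3) \<open>\<epsilon> > 0\<close> by (auto simp: \<delta>_def)
  have "z' \<in> closure (convex hull unit_tensors)"
    using z' cball_subset_closure_unit_tensors by blast
  then obtain w where "w \<in> convex hull unit_tensors" and wz': "dist w z' < \<epsilon> / 2"
    unfolding closure_approachable using \<open>\<epsilon> > 0\<close> by (meson half_gt_zero)
  then obtain k :: nat and l u where l: "\<And>j. j \<in> {1..k} \<Longrightarrow> 0 \<le> l j" "sum l {1..k} = 1"
    and u: "\<And>j. j \<in> {1..k} \<Longrightarrow> u j \<in> unit_tensors" and w: "(\<Sum>j\<in>{1..k}. l j *\<^sub>R u j) = w"
    unfolding convex_hull_indexed by blast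
  have "\<forall>j. \<exists>a b. j \<in> {1..k} \<longrightarrow> u j = elementary a b \<and> a \<in> cball 0 1 \<and> b \<in> cball 0 1"
    using u unfolding unit_tensors_def by blast
  then obtain a b where ab: "\<And>j. j \<in> {1..k} \<Longrightarrow> u j = elementary (a j) (b j)"
    "\<And>j. j \<in> {1..k} \<Longrightarrow> a j \<in> cball 0 1" "\<And>j. j \<in> {1..k} \<Longrightarrow> b j \<in> cball 0 1"
    by metis
  obtain x0 y0 where x0: "x0 \<in> cball 0 1" and y0: "y0 \<in> cball 0 1"
    and c0: "re_part (g (elementary x0 y0)) > c"
    using slice_contains_unit_tensor[OF g \<open>\<alpha> > 0\<close>] unfolding c_def by blast
  \<comment> \<open>the same slice of \<open>X\<close>, given by \<open>y0\<close>, serves for all \<open>j\<close>\<close>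
  obtain x P where P: "almost_fixing sX F \<delta> P" and
    x: "\<And>j. j \<in> {1..k} \<Longrightarrow> x j \<in> cball 0 1" "\<And>j. j \<in> {1..k} \<Longrightarrow> re_part (g (elementary (x j) y0)) > c"
      "\<And>j. j \<in> {1..k} \<Longrightarrow> norm (P (x j) - a j) < \<delta>"
    using WODP_several_slices[where I = "{1..k}" and a = a and c = "\<lambda>_. c"
        and f = "\<lambda>_ x. g (elementary x y0)", OF X.banach_space_axioms WX
        finite_atLeastAtMost FE(1) \<delta>(1) bounded_functional_elementary(1)[OF g]]
      ab(2) x0 c0 by blast
  \<comment> \<open>the slice of \<open>Y\<close> varies with \<open>j\<close>; each contains \<open>y0\<close> by the choice of \<open>x j\<close>\<close>
  obtain y Q where Q: "almost_fixing sY E \<delta> Q" and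
    y: "\<And>j. j \<in> {1..k} \<Longrightarrow> y j \<in> cball 0 1" "\<And>j. j \<in> {1..k} \<Longrightarrow> re_part (g (elementary (x j) (y j))) > c"
      "\<And>j. j \<in> {1..k} \<Longrightarrow> norm (Q (y j) - b j) < \<delta>"
    using WODP_several_slices[where I = "{1..k}" and a = b and c = "\<lambda>_. c"
        and f = "\<lambda>j. \<lambda>y. g (elementary (x j) y)", OF Y.banach_space_axioms WY
        finite_atLeastAtMost FE(2) \<delta>(1) bounded_functional_elementary(2)[OF g]]
      ab(3) y0 x(2) by blast
  obtain T where T: "bounded_operator sZ sZ T"
    "\<forall>x y. T (elementary x y) = elementary (P x) (Q y)" "onorm T \<le> onorm P * onorm Q"
    using tensor_product_operator[OF almost_fixingD(1)[OF P] almost_fixingD(1)[OF Q]] by blast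
  interpret T: bounded_linear T by (rule bounded_operatorD(1)[OF T(1)])
  have "onorm T \<le> (1 + \<delta>) * (1 + \<delta>)"
    using T(3) almost_fixingD(3)[OF P] almost_fixingD(3)[OF Q] \<delta>(1)
      onorm_pos_le[OF almost_fixingD(2)[OF Q]]
    by (elim order_trans) (intro mult_mono, auto)
  also have "\<dots> \<le> 1 + 3 * \<delta>"
    using \<delta> mult_right_mono[OF \<delta>(3), of \<delta>]
      by (simp only: distrib_right distrib_left mult_1_left mult_1_right) linarith
  finally have onT: "onorm T \<le> 1 + 3 * \<delta>" .
  define z where "z = (\<Sum>j\<in>{1..k}. l j *\<^sub>R elementary (x j) (y j))"
  have "elementary (x j) (y j) \<in> slice g \<alpha>" if j: "j \<in> {1..k}" for j
  proof -
    have "norm (elementary (x j) (y j)) \<le> norm (x j) * norm (y j)" by (rule norm_elementary_le)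
    also have "\<dots> \<le> 1 * 1" using x(1)[OF j] y(1)[OF j] by (intro mult_mono) auto
    finally show ?thesis using y(2)[OF j] by (simp add: slice_def c_def)
  qed
  then have z: "z \<in> slice g \<alpha>"
    unfolding z_def using l by (intro convex_sum convex_slice[OF g]) auto
  have "T z - w = (\<Sum>j\<in>{1..k}. l j *\<^sub>R (elementary (P (x j)) (Q (y j)) - elementary (a j) (b j)))"
    unfolding z_def w[symmetric] T.sum
    by (simp add: T.scaleR T(2) ab(1) scaleR_diff_right sum_subtractf)
  also have "norm \<dots> \<le> (\<Sum>j\<in>{1..k}. l j * (3 * \<delta>))"
  proof (rule sum_norm_le)
    fix j assume j: "j \<in> {1..k}"
    have "norm (Q (y j)) \<le> (1 + \<delta>) * norm (y j)" by (rule almost_fixingD(5)[OF Q])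
    also have "\<dots> \<le> 2 * 1" using \<delta> y(1)[OF j] by (intro mult_mono) auto
    finally have Qy: "\<delta> * norm (Q (y j)) \<le> \<delta> * 2" using \<delta>(1) by (intro mult_left_mono) auto
    have "norm (a j) * \<delta> \<le> 1 * \<delta>" using ab(2)[OF j] \<delta>(1) by (intro mult_right_mono) auto
    then have "norm (elementary (P (x j)) (Q (y j)) - elementary (a j) (b j)) \<le> 3 * \<delta>"
      using elementary_diff_estimate[OF less_imp_le[OF x(3)[OF j]] less_imp_le[OF y(3)[OF j]]] Qy
      by linarith
    then show "norm (l j *\<^sub>R (elementary (P (x j)) (Q (y j)) - elementary (a j) (b j))) \<le> l j * (3 * \<delta>)"
      using l(1)[OF j] by (simp add: mult_left_mono)
  qed
  also have "\<dots> = 3 * \<delta>" using l(2) by (simp add: sum_distrib_right[symmetric])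
  finally have "norm (T z - z') < \<epsilon>"
    using wz' \<delta>(4) norm_triangle_ineq[of "T z - w" "w - z'"] by (simp add: dist_norm)
  moreover have "\<forall>i\<in>{1..n}. norm (T (zs i) - zs i) < \<epsilon>"
    using FE(4)[OF almost_fixing_mono[OF P order_refl \<delta>(2)] almost_fixing_mono[OF Q order_refl \<delta>(2)]
        T.bounded_linear_axioms _ T(2)] onT \<delta>(3) by simp
  ultimately show "\<exists>z\<in>slice g \<alpha>. \<exists>T. bounded_operator sZ sZ T \<and> onorm T \<le> 1 + \<epsilon> \<and>
      (\<forall>i\<in>{1..n}. norm (T (zs i) - zs i) < \<epsilon>) \<and> norm (T z - z') < \<epsilon>"
    using z T(1) onT \<delta>(1,4) by (intro bexI[of _ z] exI[of _ T]) auto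
qed

end

theorem theorem5p4:
  fixes sX :: "'k::real_or_complex \<Rightarrow> 'x::banach \<Rightarrow> 'x"
    and sY :: "'k \<Rightarrow> 'y::banach \<Rightarrow> 'y"
    and sZ :: "'k \<Rightarrow> 'z::banach \<Rightarrow> 'z"
    and J :: "(('x \<Rightarrow> 'y \<Rightarrow> 'k) \<Rightarrow> 'k) \<Rightarrow> 'z"
  assumes "banach_space sX" and "banach_space sY"
    and "WODP sX" and "WODP sY"
    and "is_projective_tensor_product sX sY sZ J"
  shows "WODP sZ"
proof -
  interpret projective_tensor_product sX sY sZ J
    using assms(1,2,5)
    by (simp add: projective_tensor_product_def projective_tensor_product_axioms_def)
  show ?thesis by (rule WODP_projective_tensor_product[OF assms(3,4)])
qed

end
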